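(* Let $X$ be a Banach space equipped with a generalized approximation scheme $Q=(Q_n)_{n=0}^\infty$ in which each $Q_n$ is finite-dimensional. Then for every bounded linear operator $T\in\mathcal{L}(X)$ and every $n\ge 0$, $$a_n(T,Q)=a_n(T^{**},Q^{\perp\perp}).$$
   Context: $\mathcal{L}(X)$ denotes the space of bounded linear operators on the Banach space $X$, with the operator norm. A generalized approximation scheme on $X$ is a sequence $Q=(Q_n)_{n=0}^\infty$ of closed linear subspaces of $X$ such that: (GA1) $\{0\}=Q_0\subset Q_1\subset\dots\subset Q_n\subset\dots\subset X$ (inclusions not necessarily strict); (GA2) $\lambda Q_n\subset Q_n$ for all $n$ and all scalars $\lambda$; (GA3) $Q_n+Q_m\subseteq Q_{n+m}$ for all $n,m$. For a subspace $U\subset X$, $U^\perp\subset X^*$ is its annihilator and $U^{\perp\perp}=(U^\perp)^\perp\subset X^{**}$ is the annihilator of $U^\perp$ in the bidual. $T^{**}\in\mathcal{L}(X^{**})$ is the second adjoint of $T$. The approximation numbers are $$a_n(T,Q)=\inf\{\|T-A\|_{\mathcal{L}(X)} : A\in\mathcal{L}(X),\ A(X)\subseteq Q_n\},$$ $$a_n(T^{**},Q^{\perp\perp})=\inf\{\|T^{**}-B\|_{\mathcal{L}(X^{**})} : B\in\mathcal{L}(X^{**}),\ B(X^{**})\subseteq Q_n^{\perp\perp}\}.$$ *)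

theory Defs
  imports "HOL-Analysis.Analysis"
begin

section \<open>Complex Banach spaces and bounded complex-linear maps\<close>

text \<open>A Banach space may be real or complex. HOL-Analysis has only the real notion, so the complex
  one is set up here on top of it: a complex normed space is a real normed space whose scalar
  multiplication is extended to the complex numbers.\<close>

class complex_normed_vector = real_normed_vector +
  fixes scaleC :: "complex \<Rightarrow> 'a \<Rightarrow> 'a" (infixr \<open>*\<^sub>C\<close> 75)
  assumes scaleC_add_right: "c *\<^sub>C (x + y) = c *\<^sub>C x + c *\<^sub>C y"
    and scaleC_add_left: "(c + d) *\<^sub>C x = c *\<^sub>C x + d *\<^sub>C x"
    and scaleC_scaleC: "c *\<^sub>C d *\<^sub>C x = (c * d) *\<^sub>C x"
    and scaleC_of_real: "complex_of_real r *\<^sub>C x = r *\<^sub>R x"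
    and norm_scaleC: "norm (c *\<^sub>C x) = cmod c * norm x"

class cbanach = complex_normed_vector + complete_space

lemma vector_space_scaleC:
  "vector_space (scaleC :: complex \<Rightarrow> 'a \<Rightarrow> 'a::complex_normed_vector)"
proof
  fix x :: 'a
  show "1 *\<^sub>C x = x"
    using scaleC_of_real[of 1 x] by simp
qed (simp_all add: scaleC_add_right scaleC_add_left scaleC_scaleC)

lemma bounded_linear_scaleC: "bounded_linear (\<lambda>x::'a::complex_normed_vector. c *\<^sub>C x)"
proof (rule bounded_linear_intro[where K = "cmod c"])
  fix x y :: 'a and r :: real
  show "c *\<^sub>C (x + y) = c *\<^sub>C x + c *\<^sub>C y"
    by (rule scaleC_add_right)
  show "c *\<^sub>C (r *\<^sub>R x) = r *\<^sub>R (c *\<^sub>C x)"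
    by (simp add: scaleC_of_real[symmetric] scaleC_scaleC mult.commute)
  show "norm (c *\<^sub>C x) \<le> norm x * cmod c"
    by (simp add: norm_scaleC)
qed

instantiation complex :: complex_normed_vector
begin
definition scaleC_complex :: "complex \<Rightarrow> complex \<Rightarrow> complex" where "scaleC_complex = (*)"
instance
  by standard (simp_all add: scaleC_complex_def algebra_simps norm_mult scaleR_conv_of_real)
end

instance complex :: cbanach ..

typedef (overloaded) ('a, 'b) cblinfun (\<open>(_ \<Rightarrow>\<^sub>C\<^sub>L /_)\<close> [22, 21] 21) =
  "{f :: 'a::complex_normed_vector \<Rightarrow> 'b::complex_normed_vector.
      bounded_linear f \<and> (\<forall>c x. f (c *\<^sub>C x) = c *\<^sub>C f x)}"
  morphisms cblinfun_apply CBlinfun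
  by (rule exI[of _ "\<lambda>_. 0"])
    (auto simp: bounded_linear_zero linear_0[OF bounded_linear.linear, OF bounded_linear_scaleC])

setup_lifting type_definition_cblinfun

instantiation cblinfun :: (complex_normed_vector, complex_normed_vector) complex_normed_vector
begin

lift_definition norm_cblinfun :: "'a \<Rightarrow>\<^sub>C\<^sub>L 'b \<Rightarrow> real" is onorm .

lift_definition zero_cblinfun :: "'a \<Rightarrow>\<^sub>C\<^sub>L 'b" is "\<lambda>x. 0"
  by (auto simp: bounded_linear_zero linear_0[OF bounded_linear.linear, OF bounded_linear_scaleC])

lift_definition plus_cblinfun :: "'a \<Rightarrow>\<^sub>C\<^sub>L 'b \<Rightarrow> 'a \<Rightarrow>\<^sub>C\<^sub>L 'b \<Rightarrow> 'a \<Rightarrow>\<^sub>C\<^sub>L 'b" is "\<lambda>f g x. f x + g x"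
  by (auto simp: bounded_linear_add scaleC_add_right)

lift_definition minus_cblinfun :: "'a \<Rightarrow>\<^sub>C\<^sub>L 'b \<Rightarrow> 'a \<Rightarrow>\<^sub>C\<^sub>L 'b \<Rightarrow> 'a \<Rightarrow>\<^sub>C\<^sub>L 'b" is "\<lambda>f g x. f x - g x"
  by (auto simp: bounded_linear_sub
      linear_diff[OF bounded_linear.linear, OF bounded_linear_scaleC])

lift_definition uminus_cblinfun :: "'a \<Rightarrow>\<^sub>C\<^sub>L 'b \<Rightarrow> 'a \<Rightarrow>\<^sub>C\<^sub>L 'b" is "\<lambda>f x. - f x"
  by (auto simp: bounded_linear_minus
      linear_neg[OF bounded_linear.linear, OF bounded_linear_scaleC])

lift_definition scaleC_cblinfun :: "complex \<Rightarrow> 'a \<Rightarrow>\<^sub>C\<^sub>L 'b \<Rightarrow> 'a \<Rightarrow>\<^sub>C\<^sub>L 'b" is "\<lambda>c f x. c *\<^sub>C f x"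
  by (auto simp: scaleC_scaleC mult.commute intro: bounded_linear_compose[OF bounded_linear_scaleC])

definition scaleR_cblinfun :: "real \<Rightarrow> 'a \<Rightarrow>\<^sub>C\<^sub>L 'b \<Rightarrow> 'a \<Rightarrow>\<^sub>C\<^sub>L 'b"
  where "scaleR_cblinfun r f = complex_of_real r *\<^sub>C f"

definition sgn_cblinfun :: "'a \<Rightarrow>\<^sub>C\<^sub>L 'b \<Rightarrow> 'a \<Rightarrow>\<^sub>C\<^sub>L 'b"
  where "sgn_cblinfun f = scaleR (inverse (norm f)) f"

definition dist_cblinfun :: "'a \<Rightarrow>\<^sub>C\<^sub>L 'b \<Rightarrow> 'a \<Rightarrow>\<^sub>C\<^sub>L 'b \<Rightarrow> real"
  where "dist_cblinfun f g = norm (f - g)"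

definition [code del]:
  "(uniformity :: (('a \<Rightarrow>\<^sub>C\<^sub>L 'b) \<times> ('a \<Rightarrow>\<^sub>C\<^sub>L 'b)) filter) =
    (INF e\<in>{0 <..}. principal {(f, g). dist f g < e})"

definition open_cblinfun :: "('a \<Rightarrow>\<^sub>C\<^sub>L 'b) set \<Rightarrow> bool"
  where [code del]:
    "open_cblinfun S = (\<forall>f\<in>S. \<forall>\<^sub>F (f', g) in uniformity. f' = f \<longrightarrow> g \<in> S)"

instance
proof
  fix f g h :: "'a \<Rightarrow>\<^sub>C\<^sub>L 'b" and r s :: real and c d :: complex
  show "dist f g = norm (f - g)"
    by (rule dist_cblinfun_def)
  show "(uniformity :: (('a \<Rightarrow>\<^sub>C\<^sub>L 'b) \<times> ('a \<Rightarrow>\<^sub>C\<^sub>L 'b)) filter) =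
      (INF e\<in>{0 <..}. principal {(f, g). dist f g < e})"
    by (rule uniformity_cblinfun_def)
  show "open S = (\<forall>f\<in>S. \<forall>\<^sub>F (f', g) in uniformity. f' = f \<longrightarrow> g \<in> S)"
    for S :: "('a \<Rightarrow>\<^sub>C\<^sub>L 'b) set"
    by (rule open_cblinfun_def)
  show "sgn f = scaleR (inverse (norm f)) f"
    by (rule sgn_cblinfun_def)
  show "f + g + h = f + (g + h)" "0 + f = f" "f + g = g + f" "- f + f = 0" "f - g = f + - g"
    by (transfer; simp add: fun_eq_iff)+
  show "c *\<^sub>C (f + g) = c *\<^sub>C f + c *\<^sub>C g" "(c + d) *\<^sub>C f = c *\<^sub>C f + d *\<^sub>C f"
    "c *\<^sub>C d *\<^sub>C f = (c * d) *\<^sub>C f"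
    by (transfer; simp add: fun_eq_iff scaleC_add_right scaleC_add_left scaleC_scaleC)+
  show "complex_of_real r *\<^sub>C f = r *\<^sub>R f"
    by (simp add: scaleR_cblinfun_def)
  show "r *\<^sub>R (f + g) = r *\<^sub>R f + r *\<^sub>R g" "(r + s) *\<^sub>R f = r *\<^sub>R f + s *\<^sub>R f"
    "r *\<^sub>R s *\<^sub>R f = (r * s) *\<^sub>R f" "1 *\<^sub>R f = f"
    unfolding scaleR_cblinfun_def
    by (transfer; simp add: fun_eq_iff scaleC_of_real scaleR_add_left scaleR_add_right del: of_real_mult of_real_add of_real_1)+
  show "(norm f = 0) = (f = 0)"
    by transfer (auto simp: onorm_eq_0 fun_eq_iff)
  show "norm (f + g) \<le> norm f + norm g"
    by transfer (auto simp: onorm_triangle)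
  show "norm (r *\<^sub>R f) = \<bar>r\<bar> * norm f"
    unfolding scaleR_cblinfun_def
    by transfer (simp add: scaleC_of_real onorm_scaleR)
  show "norm (c *\<^sub>C f) = cmod c * norm f"
  proof (transfer fixing: c)
    fix f :: "'a \<Rightarrow> 'b"
    assume "bounded_linear f \<and> (\<forall>c x. f (c *\<^sub>C x) = c *\<^sub>C f x)"
    then have f: "bounded_linear f" by simp
    have "onorm (\<lambda>x. c *\<^sub>C f x) = onorm (\<lambda>x. cmod c *\<^sub>R f x)"
      by (simp add: onorm_def norm_scaleC)
    also have "\<dots> = cmod c * onorm f"
      using onorm_scaleR[OF f, of "cmod c"] by simp
    finally show "onorm (\<lambda>x. c *\<^sub>C f x) = cmod c * onorm f" .
  qed
qed

end


section \<open>Generalized approximation schemes\<close>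

text \<open>The parameter \<open>smul\<close> is the scalar multiplication: \<^const>\<open>scaleR\<close> for real and
  \<^const>\<open>scaleC\<close> for complex spaces.\<close>

definition gen_approx_scheme ::
  "('k::field \<Rightarrow> 'a \<Rightarrow> 'a) \<Rightarrow> (nat \<Rightarrow> 'a::real_normed_vector set) \<Rightarrow> bool" where
  "gen_approx_scheme smul Q \<longleftrightarrow>
     (\<forall>n. module.subspace smul (Q n) \<and> closed (Q n)) \<and>
     Q 0 = {0} \<and> (\<forall>n. Q n \<subseteq> Q (Suc n)) \<and>
     (\<forall>n c. smul c ` Q n \<subseteq> Q n) \<and>
     (\<forall>n m. {x + y | x y. x \<in> Q n \<and> y \<in> Q m} \<subseteq> Q (n + m))"

definition finite_dimensional :: "('k::field \<Rightarrow> 'a \<Rightarrow> 'a) \<Rightarrow> 'a::ab_group_add set \<Rightarrow> bool" where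
  "finite_dimensional smul V \<longleftrightarrow> (\<exists>B. finite B \<and> module.span smul B = V)"


section \<open>Annihilators, adjoints and approximation numbers\<close>

subsection \<open>Real spaces\<close>

definition annihilator :: "'a::real_normed_vector set \<Rightarrow> ('a \<Rightarrow>\<^sub>L real) set" where
  "annihilator U = {f. \<forall>x\<in>U. blinfun_apply f x = 0}"

lift_definition dual_map ::
  "('a::real_normed_vector \<Rightarrow>\<^sub>L 'b::real_normed_vector) \<Rightarrow> ('b \<Rightarrow>\<^sub>L real) \<Rightarrow>\<^sub>L ('a \<Rightarrow>\<^sub>L real)"
  is "\<lambda>T f. f o\<^sub>L T"
  by (rule bounded_bilinear.bounded_linear_left[OF bounded_bilinear_blinfun_compose])

definition approx_number ::
  "('a::real_normed_vector \<Rightarrow>\<^sub>L 'a) \<Rightarrow> (nat \<Rightarrow> 'a set) \<Rightarrow> nat \<Rightarrow> real" where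
  "approx_number T Q n = Inf {norm (T - A) | A :: 'a \<Rightarrow>\<^sub>L 'a. range (blinfun_apply A) \<subseteq> Q n}"

subsection \<open>Complex spaces\<close>

definition cannihilator :: "'a::complex_normed_vector set \<Rightarrow> ('a \<Rightarrow>\<^sub>C\<^sub>L complex) set" where
  "cannihilator U = {f. \<forall>x\<in>U. cblinfun_apply f x = 0}"

lift_definition cblinfun_compose ::
  "('b::complex_normed_vector \<Rightarrow>\<^sub>C\<^sub>L 'c::complex_normed_vector) \<Rightarrow>
   ('a::complex_normed_vector \<Rightarrow>\<^sub>C\<^sub>L 'b) \<Rightarrow> ('a \<Rightarrow>\<^sub>C\<^sub>L 'c)" (infixl \<open>o\<^sub>C\<^sub>L\<close> 55) is "(o)"
  by (auto simp: o_def bounded_linear_compose)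

lift_definition cdual_map ::
  "('a::complex_normed_vector \<Rightarrow>\<^sub>C\<^sub>L 'b::complex_normed_vector) \<Rightarrow>
   ('b \<Rightarrow>\<^sub>C\<^sub>L complex) \<Rightarrow>\<^sub>C\<^sub>L ('a \<Rightarrow>\<^sub>C\<^sub>L complex)"
  is "\<lambda>T f. f o\<^sub>C\<^sub>L T"
proof (intro conjI allI)
  fix T :: "'a \<Rightarrow>\<^sub>C\<^sub>L 'b"
  show "bounded_linear (\<lambda>f :: 'b \<Rightarrow>\<^sub>C\<^sub>L complex. f o\<^sub>C\<^sub>L T)"
  proof (rule bounded_linear_intro[where K = "norm T"])
    fix f g :: "'b \<Rightarrow>\<^sub>C\<^sub>L complex" and r :: real
    show "(f + g) o\<^sub>C\<^sub>L T = (f o\<^sub>C\<^sub>L T) + (g o\<^sub>C\<^sub>L T)"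
      by transfer (simp add: fun_eq_iff)
    show "(r *\<^sub>R f) o\<^sub>C\<^sub>L T = r *\<^sub>R (f o\<^sub>C\<^sub>L T)"
      unfolding scaleR_cblinfun_def by transfer (simp add: fun_eq_iff)
    show "norm (f o\<^sub>C\<^sub>L T) \<le> norm f * norm T"
      by transfer (auto intro: onorm_compose)
  qed
  show "(c *\<^sub>C f) o\<^sub>C\<^sub>L T = c *\<^sub>C (f o\<^sub>C\<^sub>L T)" for c and f :: "'b \<Rightarrow>\<^sub>C\<^sub>L complex"
    by transfer (simp add: fun_eq_iff)
qed

definition capprox_number ::
  "('a::complex_normed_vector \<Rightarrow>\<^sub>C\<^sub>L 'a) \<Rightarrow> (nat \<Rightarrow> 'a set) \<Rightarrow> nat \<Rightarrow> real" where
  "capprox_number T Q n = Inf {norm (T - A) | A :: 'a \<Rightarrow>\<^sub>C\<^sub>L 'a. range (cblinfun_apply A) \<subseteq> Q n}"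

end

theory Submission
  imports Defs
begin

text \<open>Passing from \<open>A\<close> to \<open>A\<^sup>*\<^sup>*\<close> does not increase the distance to \<open>T\<close>, which gives one inequality.
  For the other, let \<open>J\<close> be the canonical embedding into the bidual. A functional on \<open>X\<^sup>*\<close> that
  vanishes on the common kernel of finitely many evaluations is a linear combination of them, so
  \<open>J\<close> maps a finite-dimensional \<open>Q\<^sub>n\<close> onto its double annihilator. Hence an approximant \<open>B\<close> of \<open>T\<^sup>*\<^sup>*\<close>
  gives the approximant \<open>J\<^sup>-\<^sup>1 B J\<close> of \<open>T\<close>, and \<open>J T = T\<^sup>*\<^sup>* J\<close> with \<open>J\<close> isometric bounds the error.\<close>

section \<open>Norming functionals\<close>

text \<open>Homogeneity is asked for as a single inequality, which is convenient to check for
  infima; applying it to \<open>inverse t\<close> as well gives the equality in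
  \<open>sublinear_scale\<close>.\<close>

definition sublinear :: "('a::real_vector \<Rightarrow> real) \<Rightarrow> bool" where
  "sublinear p \<longleftrightarrow> (\<forall>x y. p (x + y) \<le> p x + p y) \<and> (\<forall>t>0. \<forall>x. p (t *\<^sub>R x) \<le> t * p x)"

lemma sublinear_add: "sublinear p \<Longrightarrow> p (x + y) \<le> p x + p y"
  by (simp add: sublinear_def)

lemma sublinear_scale:
  assumes "sublinear p" "t > 0"
  shows "p (t *\<^sub>R x) = t * p x"
proof (rule antisym)
  show "p (t *\<^sub>R x) \<le> t * p x"
    using assms by (simp add: sublinear_def)
  have "p (inverse t *\<^sub>R t *\<^sub>R x) \<le> inverse t * p (t *\<^sub>R x)"
    using assms unfolding sublinear_def by (metis inverse_positive_iff_positive)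
  then show "t * p x \<le> p (t *\<^sub>R x)"
    using assms by (simp add: field_simps)
qed

lemma sublinear_zero: "sublinear p \<Longrightarrow> p 0 = 0"
  using sublinear_scale[of p 2 0] by simp

lemma sublinear_minus: "sublinear p \<Longrightarrow> - p (- x) \<le> p x"
  using sublinear_add[of p x "- x"] sublinear_zero[of p] by simp

text \<open>Minimizing \<open>p (x + t y) - t p y\<close> over t \<ge> 0 preserves sublinearity. The
  parameter 0 gives \<open>q \<le> p\<close>; the parameter 1, at the point \<open>- y\<close>,
  gives the bound that pushes \<open>q\<close> towards oddness at \<open>y\<close>.\<close>

lemma sublinear_decrease:
  assumes p: "sublinear p"
  obtains q where "sublinear q" "q \<le> p" "q (- y) \<le> - p y"
proof -
  define g where "g = (\<lambda>x t. p (x + t *\<^sub>R y) - t * p y)"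
  define q where "q = (\<lambda>x. INF t\<in>{0..}. g x t)"
  have scale: "p (t *\<^sub>R x) = t * p x" if "t \<ge> 0" for t x
    using that sublinear_scale[OF p, of t x] sublinear_zero[OF p] by (cases "t = 0") auto
  \<comment> \<open>Splitting \<open>t y\<close> as \<open>(x + t y) + (- x)\<close> yields a lower
    bound independent of \<open>t\<close>, so the infimum is finite.\<close>
  have lower: "- p (- x) \<le> g x t" if "t \<ge> 0" for x t
    using sublinear_add[OF p, of "x + t *\<^sub>R y" "- x"] scale[OF that, of y] by (simp add: g_def)
  have bdd: "bdd_below (g x ` {0..})" for x
    by (rule bdd_belowI2[where m = "- p (- x)"]) (simp add: lower)
  have q_le: "q x \<le> g x t" if "t \<ge> 0" for x t
    unfolding q_def using bdd that by (intro cINF_lower) auto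
  have q_ge: "c \<le> q x" if "\<And>t. t \<ge> 0 \<Longrightarrow> c \<le> g x t" for c x
    unfolding q_def using that by (intro cINF_greatest) auto
  have add: "q (x + z) \<le> q x + q z" for x z
  proof -
    \<comment> \<open>Parameters add: \<open>t\<close> for \<open>x\<close> and \<open>u\<close> for
      \<open>z\<close> combine to \<open>t + u\<close> for \<open>x + z\<close>.\<close>
    have "q (x + z) \<le> g x t + g z u" if "t \<ge> 0" "u \<ge> 0" for t u
    proof -
      have "q (x + z) \<le> g (x + z) (t + u)"
        using that by (intro q_le) simp
      also have "\<dots> \<le> g x t + g z u"
        using sublinear_add[OF p, of "x + t *\<^sub>R y" "z + u *\<^sub>R y"]
        by (simp add: g_def algebra_simps)
      finally show ?thesis .
    qed
    \<comment> \<open>The infima are taken one after the other, over \<open>u\<close> with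
      \<open>t\<close> fixed and then over \<open>t\<close>.\<close>
    then have "q (x + z) - g x t \<le> q z" if "t \<ge> 0" for t
      using that by (intro q_ge) (simp add: algebra_simps)
    then have "q (x + z) - q z \<le> q x"
      by (intro q_ge) (simp add: algebra_simps)
    then show ?thesis by simp
  qed
  have homogeneous: "q (s *\<^sub>R x) \<le> s * q x" if s: "s > 0" for s x
  proof -
    have "q (s *\<^sub>R x) / s \<le> q x"
    proof (rule q_ge)
      fix t :: real
      assume "t \<ge> 0"
      \<comment> \<open>The parameter scales with the vector, since
        \<open>s x + (s t) y = s (x + t y)\<close>.\<close>
      then have "q (s *\<^sub>R x) \<le> g (s *\<^sub>R x) (s * t)"
        using s by (intro q_le) simp
      also have "\<dots> = s * g x t"
        using sublinear_scale[OF p s, of "x + t *\<^sub>R y"] by (simp add: g_def algebra_simps)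
      finally show "q (s *\<^sub>R x) / s \<le> g x t"
        using s by (simp add: field_simps)
    qed
    then show ?thesis using s by (simp add: field_simps)
  qed
  have "sublinear q"
    by (simp add: sublinear_def add homogeneous)
  moreover have "q \<le> p"
    using q_le[of 0] by (simp add: le_fun_def g_def)
  moreover have "q (- y) \<le> - p y"
    using q_le[of 1 "- y"] by (simp add: g_def sublinear_zero[OF p])
  ultimately show ?thesis by (rule that)
qed

text \<open>Hahn--Banach: a minimal sublinear functional is linear, because
  \<open>sublinear_decrease\<close> cannot strictly decrease it.\<close>

lemma sublinear_dominates_linear:
  assumes p: "sublinear p"
  obtains f where "linear f" "\<And>x. f x \<le> p x" "f y = p y"
proof -
  \<comment> \<open>The condition at \<open>- y\<close> passes to infima; for an odd member it gives
    \<open>p y \<le> q y\<close>, which with \<open>q \<le> p\<close> fixes the value at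
    \<open>y\<close>.\<close>
  define A where "A = {q. sublinear q \<and> q \<le> p \<and> q (- y) \<le> - p y}"
  \<comment> \<open>Zorn's lemma for the reversed order: lower bounds of chains give a minimal
    element.\<close>
  have "\<exists>m\<in>A. \<forall>q\<in>A. m \<ge> q \<longrightarrow> q = m"
  proof (rule predicate_Zorn)
    show "partial_order_on A (relation_of (\<ge>) A)"
      by (rule partial_order_on_relation_ofI) auto
    fix C
    assume C: "C \<in> Chains (relation_of (\<ge>) A)"
    show "\<exists>u\<in>A. \<forall>q\<in>C. q \<ge> u"
    proof (cases "C = {}")
      \<comment> \<open>An infimum over the empty chain has no meaning, so here the bound is any
        member of \<open>A\<close>, obtained by decreasing \<open>p\<close>.\<close>
      case True
      then show ?thesis
        using sublinear_decrease[OF p, of y] by (auto simp: A_def)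
    next
      case False
      have CA: "q \<in> A" if "q \<in> C" for q
        using C that by (auto simp: Chains_def relation_of_def)
      have total: "q \<le> r \<or> r \<le> q" if "q \<in> C" "r \<in> C" for q r
        using C that by (auto simp: Chains_def relation_of_def)
      define u where "u = (\<lambda>x. INF q\<in>C. q x)"
      \<comment> \<open>The bound depends on \<open>p\<close> alone, hence is uniform in the chain
        and makes the pointwise infimum finite.\<close>
      have lower: "- p (- x) \<le> q x" if "q \<in> C" for q x
      proof -
        have "q (- x) \<le> p (- x)" "- q (- x) \<le> q x"
          using CA[OF that] sublinear_minus[of q x] by (auto simp: A_def le_fun_def)
        then show ?thesis by linarith
      qed
      have bdd: "bdd_below ((\<lambda>q. q x) ` C)" for x
        by (rule bdd_belowI2[where m = "- p (- x)"]) (rule lower)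
      have u_le: "u x \<le> q x" if "q \<in> C" for q x
        unfolding u_def using bdd that by (rule cINF_lower)
      have u_ge: "c \<le> u x" if "\<And>q. q \<in> C \<Longrightarrow> c \<le> q x" for c x
        unfolding u_def using False that by (rule cINF_greatest)
      have add: "u (x + z) \<le> u x + u z" for x z
      proof -
        have "u (x + z) \<le> q x + r z" if q: "q \<in> C" and r: "r \<in> C" for q r
        proof -
          \<comment> \<open>The chain property replaces \<open>q\<close> and \<open>r\<close> by the
            smaller of the two, whose subadditivity can then be used at both points.\<close>
          obtain m where m: "m \<in> C" "m \<le> q" "m \<le> r"
            using total[OF q r] q r by blast
          have "u (x + z) \<le> m (x + z)"
            using m by (intro u_le)
          also have "\<dots> \<le> m x + m z"
            using CA[OF m(1)] by (simp add: A_def sublinear_add)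
          also have "\<dots> \<le> q x + r z"
            using m by (intro add_mono) (auto simp: le_fun_def)
          finally show ?thesis .
        qed
        then have "u (x + z) - q x \<le> u z" if "q \<in> C" for q
          using that by (intro u_ge) (metis add.commute diff_le_eq)
        then have "u (x + z) - u z \<le> u x"
          by (intro u_ge) (simp add: algebra_simps)
        then show ?thesis by simp
      qed
      have homogeneous: "u (t *\<^sub>R x) \<le> t * u x" if t: "t > 0" for t x
      proof -
        have "u (t *\<^sub>R x) / t \<le> u x"
        proof (rule u_ge)
          fix q
          assume q: "q \<in> C"
          then show "u (t *\<^sub>R x) / t \<le> q x"
            using u_le[OF q, of "t *\<^sub>R x"] sublinear_scale[of q t x] CA[OF q] t
            by (simp add: A_def field_simps)
        qed
        then show ?thesis using t by (simp add: field_simps)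
      qed
      obtain q where q: "q \<in> C"
        using False by blast
      have "u \<le> p" "u (- y) \<le> - p y"
        using CA[OF q] u_le[OF q] by (force simp: A_def le_fun_def intro: order_trans)+
      then have "u \<in> A"
        by (simp add: A_def sublinear_def add homogeneous)
      then show ?thesis
        using u_le by (auto simp: le_fun_def)
    qed
  qed
  then obtain m where m: "m \<in> A" and minimal: "\<And>q. q \<in> A \<Longrightarrow> q \<le> m \<Longrightarrow> q = m"
    by blast
  then have sm: "sublinear m" and mp: "m \<le> p" and my: "m (- y) \<le> - p y"
    by (auto simp: A_def)
  \<comment> \<open>Decreasing \<open>m\<close> in the direction \<open>z\<close> stays inside
    \<open>A\<close>, so by minimality nothing changes and \<open>m (- z) \<le> - m z\<close>; the
    reverse inequality holds for every sublinear functional.\<close>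
  have odd: "m (- z) = - m z" for z
  proof -
    obtain q where q: "sublinear q" "q \<le> m" "q (- z) \<le> - m z"
      using sublinear_decrease[OF sm] .
    then have "q (- y) \<le> - p y"
      using my by (meson le_funD order_trans)
    then have "q = m"
      using q mp by (intro minimal) (auto simp: A_def)
    then show ?thesis
      using q sublinear_minus[OF sm, of z] by simp
  qed
  \<comment> \<open>Subadditivity at \<open>x + z\<close> and \<open>- z\<close>, combined with
    oddness, is the missing inequality.\<close>
  have add: "m (x + z) = m x + m z" for x z
    using sublinear_add[OF sm, of x z] sublinear_add[OF sm, of "x + z" "- z"] odd[of z] by simp
  have scale: "m (t *\<^sub>R x) = t * m x" for t x
  proof (cases t "0 :: real" rule: linorder_cases)
    case less
    then show ?thesis
      using sublinear_scale[OF sm, of "- t" x] odd[of "t *\<^sub>R x"] by simp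
  next
    case equal
    then show ?thesis by (simp add: sublinear_zero[OF sm])
  next
    case greater
    then show ?thesis by (rule sublinear_scale[OF sm])
  qed
  have "m y = p y"
    using my odd[of y] le_funD[OF mp, of y] by simp
  then show ?thesis
    using mp by (intro that[of m] linearI) (auto simp: le_fun_def add scale)
qed

text \<open>Hahn-Banach with the norm as dominating functional; the norm is even, so the bounds at
  \<open>x\<close> and \<open>- x\<close> control the absolute value.\<close>

lemma norming_functional:
  fixes y :: "'a::real_normed_vector"
  obtains f :: "'a \<Rightarrow> real" where "linear f" "\<And>x. \<bar>f x\<bar> \<le> norm x" "f y = norm y"
proof -
  have "sublinear (norm :: 'a \<Rightarrow> real)"
    by (simp add: sublinear_def norm_triangle_ineq)
  then obtain f :: "'a \<Rightarrow> real" where f: "linear f" "\<And>x. f x \<le> norm x" "f y = norm y"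
    using sublinear_dominates_linear[of norm y] by metis
  have "\<bar>f x\<bar> \<le> norm x" for x
    using f(2)[of x] f(2)[of "- x"] linear_neg[OF f(1), of x] by simp
  with f show ?thesis using that by metis
qed


section \<open>Finite-dimensional subspaces and their double annihilators\<close>

text \<open>The algebraic core, for a bilinear pairing \<open>e\<close> over any field, so that it
  serves real and complex duals alike. Induction on a finite spanning set splits off one evaluation
  at a time.\<close>

lemma functional_eq_evaluation:
  fixes s :: "'k::field \<Rightarrow> 'a::ab_group_add \<Rightarrow> 'a"
    and s' :: "'k \<Rightarrow> 'd::ab_group_add \<Rightarrow> 'd"
    and e :: "'d \<Rightarrow> 'a \<Rightarrow> 'k"
  assumes e_right: "\<And>f. Vector_Spaces.linear s (*) (e f)"
    and e_left: "\<And>x. Vector_Spaces.linear s' (*) (\<lambda>f. e f x)"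
    and "finite_dimensional s V"
    and "Vector_Spaces.linear s' (*) \<phi>"
    and "\<And>f. (\<forall>x\<in>V. e f x = 0) \<Longrightarrow> \<phi> f = 0"
  shows "\<exists>x\<in>V. \<forall>f. \<phi> f = e f x"
proof -
  interpret s: vector_space s
    using e_right[of 0] by (simp add: Vector_Spaces.linear_def)
  interpret e_right: Vector_Spaces.linear s "(*)" "e f" for f
    by (rule e_right)
  interpret e_left: Vector_Spaces.linear s' "(*)" "\<lambda>f. e f x" for x
    by (rule e_left)
  \<comment> \<open>The functional is generalized along with \<open>B\<close>, because the induction
    step modifies it.\<close>
  have "\<exists>x\<in>s.span B. \<forall>f. \<phi> f = e f x"
    if "finite B" "Vector_Spaces.linear s' (*) \<phi>"
      "\<And>f. (\<forall>x\<in>B. e f x = 0) \<Longrightarrow> \<phi> f = 0" for B \<phi>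
    using that
  proof (induction B arbitrary: \<phi> rule: finite_induct)
    case empty
    then show ?case
      by (simp add: e_right.zero)
  next
    case (insert b B)
    interpret \<phi>: Vector_Spaces.linear s' "(*)" \<phi>
      by (rule insert.prems)
    show ?case
    proof (cases "\<exists>g. (\<forall>x\<in>B. e g x = 0) \<and> e g b \<noteq> 0")
      \<comment> \<open>Whatever vanishes on \<open>B\<close> vanishes at \<open>b\<close> too, so
        \<open>b\<close> adds no condition.\<close>
      case False
      then have "\<exists>x\<in>s.span B. \<forall>f. \<phi> f = e f x"
        using insert.prems by (intro insert.IH) auto
      then show ?thesis
        using s.span_mono[of B "insert b B"] by blast
    next
      case True
      then obtain g where g: "\<forall>x\<in>B. e g x = 0" "e g b \<noteq> 0"
        by blast
      \<comment> \<open>This is the only coefficient for which subtracting \<open>c\<close> times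
        the evaluation at \<open>b\<close> kills \<open>g\<close>.\<close>
      define c where "c = \<phi> g / e g b"
      have "\<exists>x\<in>s.span B. \<forall>f. \<phi> f - c * e f b = e f x"
      proof (rule insert.IH)
        show "Vector_Spaces.linear s' (*) (\<lambda>f. \<phi> f - c * e f b)"
          using insert.prems(1) unfolding Vector_Spaces.linear_iff
          by (simp add: e_left.add e_left.scale algebra_simps)
        fix f
        assume f: "\<forall>x\<in>B. e f x = 0"
        \<comment> \<open>The multiple of \<open>g\<close> is chosen to cancel the value at
          \<open>b\<close> while leaving the zeros on \<open>B\<close> intact.\<close>
        have "\<phi> (f - s' (e f b / e g b) g) = 0"
          using f g by (intro insert.prems) (auto simp: e_left.diff e_left.scale)
        then show "\<phi> f - c * e f b = 0"
          by (simp add: c_def \<phi>.diff \<phi>.scale mult.commute)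
      qed
      then obtain x where x: "x \<in> s.span B" "\<And>f. \<phi> f - c * e f b = e f x"
        by blast
      have "x + s c b \<in> s.span (insert b B)"
        using subsetD[OF s.span_mono[OF subset_insertI] x(1)]
        by (intro s.span_add s.span_scale) (auto intro: s.span_base)
      moreover have "\<phi> f = e f (x + s c b)" for f
        using x(2)[of f] by (simp add: e_right.add e_right.scale algebra_simps)
      ultimately show ?thesis by blast
    qed
  qed
  moreover obtain B where "finite B" "s.span B = V"
    using assms(3) by (auto simp: finite_dimensional_def)
  \<comment> \<open>Vanishing on \<open>B\<close> implies vanishing on its span \<open>V\<close>, so
    the hypothesis on \<open>V\<close> applies.\<close>
  ultimately show ?thesis
    using assms(4,5) e_right.eq_0_on_span by metis
qed


section \<open>Real spaces\<close>

lift_definition bidual_embedding :: "'a::real_normed_vector \<Rightarrow> ('a \<Rightarrow>\<^sub>L real) \<Rightarrow>\<^sub>L real"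
  is "\<lambda>x f. blinfun_apply f x"
  by (rule blinfun.bounded_linear_left)

lemma bidual_embedding_add: "bidual_embedding (x + y) = bidual_embedding x + bidual_embedding y"
  by (rule blinfun_eqI) (simp add: bidual_embedding.rep_eq blinfun.bilinear_simps)

lemma bidual_embedding_diff: "bidual_embedding (x - y) = bidual_embedding x - bidual_embedding y"
  by (rule blinfun_eqI) (simp add: bidual_embedding.rep_eq blinfun.bilinear_simps)

lemma bidual_embedding_scaleR: "bidual_embedding (r *\<^sub>R x) = r *\<^sub>R bidual_embedding x"
  by (rule blinfun_eqI) (simp add: bidual_embedding.rep_eq blinfun.bilinear_simps)

text \<open>One inequality is the operator norm bound for \<open>f\<close>; the other tests the
  embedded vector on a norming functional of norm at most 1.\<close>

lemma norm_bidual_embedding: "norm (bidual_embedding x) = norm x"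
proof (rule antisym)
  show "norm (bidual_embedding x) \<le> norm x"
  proof (rule norm_blinfun_bound)
    show "norm (blinfun_apply (bidual_embedding x) f) \<le> norm x * norm f" for f
      using norm_blinfun[of f x] by (simp add: bidual_embedding.rep_eq mult.commute)
  qed simp
  obtain f where f: "linear f" "\<And>z. \<bar>f z\<bar> \<le> norm z" "f x = norm x"
    using norming_functional[of x] by metis
  have "bounded_linear f"
    using f by (intro bounded_linear_intro[where K = 1]) (auto simp: linear_add linear_cmul)
  then obtain F where F: "blinfun_apply F = f"
    using bounded_linear_Blinfun_apply by blast
  have "norm F \<le> 1"
    by (rule norm_blinfun_bound) (use f in \<open>auto simp: F\<close>)
  have "norm x \<le> norm (bidual_embedding x) * norm F"
    using norm_blinfun[of "bidual_embedding x" F] f(3) by (simp add: bidual_embedding.rep_eq F)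
  also have "\<dots> \<le> norm (bidual_embedding x)"
    using \<open>norm F \<le> 1\<close> by (simp add: mult_left_le)
  finally show "norm x \<le> norm (bidual_embedding x)" .
qed

lemma bidual_embedding_eq_iff: "bidual_embedding x = bidual_embedding y \<longleftrightarrow> x = y"
  using norm_bidual_embedding[of "x - y"] by (auto simp: bidual_embedding_diff)

section \<open>Adjoints and second adjoints\<close>

lemma dual_map_diff: "dual_map (S - T) = dual_map S - dual_map T"
  by (intro blinfun_eqI) (simp add: dual_map.rep_eq blinfun.bilinear_simps)

lemma norm_dual_map_le: "norm (dual_map T) \<le> norm T"
proof (rule norm_blinfun_bound)
  show "norm (blinfun_apply (dual_map T) f) \<le> norm T * norm f" for f
    using norm_blinfun_compose[of f T] by (simp add: dual_map.rep_eq mult.commute)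
qed simp

text \<open>Both sides send \<open>f\<close> to \<open>f (T x)\<close>. This naturality turns errors
  in the bidual into errors in the space.\<close>

lemma dual_map_dual_map_bidual_embedding:
  "blinfun_apply (dual_map (dual_map T)) (bidual_embedding x) = bidual_embedding (blinfun_apply T x)"
  by (intro blinfun_eqI) (simp add: dual_map.rep_eq bidual_embedding.rep_eq)

text \<open>The adjoint of \<open>A\<close> kills the annihilator of \<open>V\<close>, and the
  second adjoint evaluates its argument at \<open>f o A\<close>.\<close>

lemma range_dual_map_dual_map:
  fixes A :: "'a::real_normed_vector \<Rightarrow>\<^sub>L 'b::real_normed_vector"
  assumes "range (blinfun_apply A) \<subseteq> V"
  shows "range (blinfun_apply (dual_map (dual_map A))) \<subseteq> annihilator (annihilator V)"
proof -
  have "f o\<^sub>L A = 0" if "f \<in> annihilator V" for f :: "'b \<Rightarrow>\<^sub>L real"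
    using assms that by (intro blinfun_eqI) (auto simp: annihilator_def)
  then show ?thesis
    by (auto simp: annihilator_def dual_map.rep_eq blinfun.bilinear_simps)
qed

section \<open>Double annihilators of finite-dimensional subspaces\<close>

lemma linear_blinfun_apply: "Vector_Spaces.linear scaleR (*) (blinfun_apply f)"
  for f :: "'a::real_normed_vector \<Rightarrow>\<^sub>L real"
  by (simp add: Vector_Spaces.linear_iff blinfun.bilinear_simps real_vector.vector_space_axioms)
    (simp add: vector_space_def algebra_simps)

text \<open>Membership of \<phi> in the double annihilator is exactly the kernel hypothesis of
  \<open>functional_eq_evaluation\<close> for the pairing of a space with its dual.\<close>

lemma annihilator_annihilator_finite_dimensional:
  assumes "finite_dimensional scaleR V"
  shows "annihilator (annihilator V) = bidual_embedding ` V"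
proof
  show "bidual_embedding ` V \<subseteq> annihilator (annihilator V)"
    by (auto simp: annihilator_def bidual_embedding.rep_eq)
  show "annihilator (annihilator V) \<subseteq> bidual_embedding ` V"
  proof
    fix \<phi>
    assume \<phi>: "\<phi> \<in> annihilator (annihilator V)"
    have "\<exists>x\<in>V. \<forall>f. blinfun_apply \<phi> f = blinfun_apply f x"
    proof (rule functional_eq_evaluation[OF linear_blinfun_apply _ assms linear_blinfun_apply])
      show "Vector_Spaces.linear scaleR (*) (\<lambda>f. blinfun_apply f x)" for x :: 'a
        using linear_blinfun_apply[of "bidual_embedding x"] by (simp add: bidual_embedding.rep_eq)
      show "blinfun_apply \<phi> f = 0" if "\<forall>x\<in>V. blinfun_apply f x = 0" for f
        using \<phi> that by (simp add: annihilator_def)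
    qed
    then show "\<phi> \<in> bidual_embedding ` V"
      by (auto simp: bidual_embedding.rep_eq intro!: blinfun_eqI image_eqI)
  qed
qed

section \<open>Transfer of approximants and equality of approximation numbers\<close>

lemma bidual_approximant_restricts:
  fixes T :: "'a::real_normed_vector \<Rightarrow>\<^sub>L 'a"
  assumes B: "range (blinfun_apply B) \<subseteq> bidual_embedding ` V"
  obtains A :: "'a \<Rightarrow>\<^sub>L 'a" where "range (blinfun_apply A) \<subseteq> V"
    "norm (T - A) \<le> norm (dual_map (dual_map T) - B)"
proof -
  have "blinfun_apply B (bidual_embedding x) \<in> bidual_embedding ` V" for x
    using B by blast
  then have "\<forall>x. \<exists>v\<in>V. bidual_embedding v = blinfun_apply B (bidual_embedding x)"
    by (metis imageE)
  then obtain a where a: "\<And>x. a x \<in> V"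
      "\<And>x. bidual_embedding (a x) = blinfun_apply B (bidual_embedding x)"
    by metis
  \<comment> \<open>Injectivity of the embedding carries linearity over from \<open>B\<close>, and
    its isometry carries over the bound.\<close>
  have "bounded_linear a"
  proof (rule bounded_linear_intro[where K = "norm B"])
    show "a (x + y) = a x + a y" for x y
      by (subst bidual_embedding_eq_iff[symmetric])
        (simp add: a bidual_embedding_add blinfun.bilinear_simps)
    show "a (r *\<^sub>R x) = r *\<^sub>R a x" for r x
      by (subst bidual_embedding_eq_iff[symmetric])
        (simp add: a bidual_embedding_scaleR blinfun.bilinear_simps)
    show "norm (a x) \<le> norm x * norm B" for x
      using norm_blinfun[of B "bidual_embedding x"]
      by (simp add: a(2)[symmetric] norm_bidual_embedding mult.commute)
  qed
  then obtain A where A: "blinfun_apply A = a"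
    using bounded_linear_Blinfun_apply by blast
  have "norm (T - A) \<le> norm (dual_map (dual_map T) - B)"
  proof (rule norm_blinfun_bound)
    fix x
    have "bidual_embedding (blinfun_apply (T - A) x) =
        blinfun_apply (dual_map (dual_map T) - B) (bidual_embedding x)"
      by (simp add: A a bidual_embedding_diff blinfun.bilinear_simps
          dual_map_dual_map_bidual_embedding)
    then show "norm (blinfun_apply (T - A) x) \<le> norm (dual_map (dual_map T) - B) * norm x"
      by (metis norm_bidual_embedding norm_blinfun)
  qed simp
  then show ?thesis
    using a by (intro that[of A]) (auto simp: A)
qed

text \<open>Mutual domination suffices. Nonnegativity makes both sets bounded below, and
  \<open>S'\<close> inherits nonemptiness from \<open>S\<close>, so both infima are genuine.\<close>

lemma Inf_eq_of_mutual_le: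
  fixes S S' :: "real set"
  assumes "S \<noteq> {}" "\<And>x. x \<in> S \<Longrightarrow> 0 \<le> x" "\<And>x. x \<in> S' \<Longrightarrow> 0 \<le> x"
    and "\<And>x. x \<in> S \<Longrightarrow> \<exists>y\<in>S'. y \<le> x" "\<And>y. y \<in> S' \<Longrightarrow> \<exists>x\<in>S. x \<le> y"
  shows "Inf S = Inf S'"
proof (rule antisym)
  have "S' \<noteq> {}"
    using assms(1,4) by blast
  then show "Inf S \<le> Inf S'"
    using assms(2,5) by (intro cInf_mono bdd_belowI[of S 0]) auto
  show "Inf S' \<le> Inf S"
    using assms(1,3,4) by (intro cInf_mono bdd_belowI[of S' 0]) auto
qed

text \<open>Each approximant yields one on the other side with no larger error: by second adjoints
  upwards, by restriction along the embedding downwards.\<close>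

lemma approx_number_bidual:
  fixes T :: "'a::real_normed_vector \<Rightarrow>\<^sub>L 'a"
  assumes "finite_dimensional scaleR (Q n)" "0 \<in> Q n"
  shows "approx_number T Q n =
    approx_number (dual_map (dual_map T)) (\<lambda>k. annihilator (annihilator (Q k))) n"
  unfolding approx_number_def
proof (rule Inf_eq_of_mutual_le)
  let ?S = "{norm (T - A) | A. range (blinfun_apply A) \<subseteq> Q n}"
  let ?S' = "{norm (dual_map (dual_map T) - B) | B.
    range (blinfun_apply B) \<subseteq> annihilator (annihilator (Q n))}"
  \<comment> \<open>The zero operator is always an admissible approximant.\<close>
  have "range (blinfun_apply (0 :: 'a \<Rightarrow>\<^sub>L 'a)) \<subseteq> Q n"
    using assms(2) by auto
  then show "?S \<noteq> {}"
    by blast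
  show "\<exists>y\<in>?S'. y \<le> x" if "x \<in> ?S" for x
  proof -
    from that obtain A where A: "range (blinfun_apply A) \<subseteq> Q n" "x = norm (T - A)"
      by blast
    have "norm (dual_map (dual_map T) - dual_map (dual_map A)) \<le> x"
      unfolding A(2) dual_map_diff[symmetric] by (rule order_trans[OF norm_dual_map_le norm_dual_map_le])
    then show ?thesis
      using range_dual_map_dual_map[OF A(1)] by blast
  qed
  show "\<exists>x\<in>?S. x \<le> y" if "y \<in> ?S'" for y
  proof -
    from that obtain B where B: "range (blinfun_apply B) \<subseteq> bidual_embedding ` Q n"
        "y = norm (dual_map (dual_map T) - B)"
      using annihilator_annihilator_finite_dimensional[OF assms(1)] by auto
    obtain A where "range (blinfun_apply A) \<subseteq> Q n" "norm (T - A) \<le> y"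
      unfolding B(2) by (rule bidual_approximant_restricts[OF B(1)])
    then show ?thesis
      by blast
  qed
qed auto


section \<open>Complex spaces\<close>

lemma bounded_linear_cblinfun_apply: "bounded_linear (cblinfun_apply f)"
  using cblinfun_apply[of f] by simp

lemma cblinfun_eqI: "(\<And>x. cblinfun_apply f x = cblinfun_apply g x) \<Longrightarrow> f = g"
  by (metis cblinfun_apply_inject ext)

lemma cblinfun_right_simps:
  "cblinfun_apply f (x + y) = cblinfun_apply f x + cblinfun_apply f y"
  "cblinfun_apply f (x - y) = cblinfun_apply f x - cblinfun_apply f y"
  "cblinfun_apply f (c *\<^sub>C x) = c *\<^sub>C cblinfun_apply f x"
  "cblinfun_apply f 0 = 0"
  using cblinfun_apply[of f] bounded_linear_cblinfun_apply[of f]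
  by (auto simp: linear_simps)

lemmas cblinfun_simps = cblinfun_right_simps
  plus_cblinfun.rep_eq minus_cblinfun.rep_eq scaleC_cblinfun.rep_eq zero_cblinfun.rep_eq

lemma norm_cblinfun: "norm (cblinfun_apply f x) \<le> norm f * norm x"
  unfolding norm_cblinfun.rep_eq by (rule onorm[OF bounded_linear_cblinfun_apply])

lemma norm_cblinfun_bound:
  "0 \<le> b \<Longrightarrow> (\<And>x. norm (cblinfun_apply f x) \<le> b * norm x) \<Longrightarrow> norm f \<le> b"
  unfolding norm_cblinfun.rep_eq by (rule onorm_bound)

text \<open>Real homogeneity is the case of real scalars, so these conditions already give a bounded
  real-linear map.\<close>

lemma obtain_cblinfun:
  fixes f :: "'a::complex_normed_vector \<Rightarrow> 'b::complex_normed_vector"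
  assumes "\<And>x y. f (x + y) = f x + f y" "\<And>c x. f (c *\<^sub>C x) = c *\<^sub>C f x"
    and "\<And>x. norm (f x) \<le> norm x * K"
  obtains F where "cblinfun_apply F = f"
proof -
  have "bounded_linear f"
    by (rule bounded_linear_intro[where K = K]) (use assms in \<open>auto simp flip: scaleC_of_real\<close>)
  then show ?thesis
    using assms(2) by (intro that[of "CBlinfun f"]) (simp add: CBlinfun_inverse)
qed

text \<open>The real norming functional \<open>u\<close> is complexified to \<open>x \<mapsto> u x - \<i> u (\<i> x)\<close>.\<close>

lemma complex_norming_functional:
  fixes y :: "'a::complex_normed_vector"
  obtains F :: "'a \<Rightarrow>\<^sub>C\<^sub>L complex" where "norm F \<le> 1" "norm y \<le> cmod (cblinfun_apply F y)"
proof -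
  obtain u :: "'a \<Rightarrow> real" where u: "linear u" "\<And>x. \<bar>u x\<bar> \<le> norm x" "u y = norm y"
    using norming_functional[of y] by metis
  define f where "f = (\<lambda>x. Complex (u x) (- u (\<i> *\<^sub>C x)))"
  have add: "f (x + z) = f x + f z" for x z
    by (simp add: f_def linear_add[OF u(1)] scaleC_add_right complex_eq_iff)
  have scale: "f (c *\<^sub>C x) = c *\<^sub>C f x" for c x
  proof -
    \<comment> \<open>As \<open>u\<close> is only real-linear, both \<open>c x\<close> and
      \<open>\<i> c x\<close> are expanded with real coefficients in \<open>x\<close> and
      \<open>\<i> x\<close>.\<close>
    have c: "c *\<^sub>C x = Re c *\<^sub>R x + Im c *\<^sub>R (\<i> *\<^sub>C x)"
      by (subst complex_eq[of c])
        (simp add: scaleC_add_left scaleC_scaleC mult.commute flip: scaleC_of_real)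
    have ic: "\<i> *\<^sub>C c *\<^sub>C x = Re c *\<^sub>R (\<i> *\<^sub>C x) - Im c *\<^sub>R x"
    proof -
      have "\<i> *\<^sub>C c *\<^sub>C x = (of_real (Re c) * \<i> + of_real (- Im c)) *\<^sub>C x"
        by (subst complex_eq[of c]) (simp add: scaleC_scaleC algebra_simps)
      also have "\<dots> = Re c *\<^sub>R (\<i> *\<^sub>C x) + (- Im c) *\<^sub>R x"
        unfolding scaleC_add_left by (simp only: scaleC_of_real flip: scaleC_scaleC)
      finally show ?thesis by simp
    qed
    show ?thesis
      unfolding f_def ic unfolding c
      by (simp add: linear_add[OF u(1)] linear_diff[OF u(1)] linear_cmul[OF u(1)]
          scaleC_complex_def complex_eq_iff algebra_simps)
  qed
  have bound: "cmod (f x) \<le> norm x" for x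
  proof -
    \<comment> \<open>A unit scalar rotates \<open>f x\<close> onto its modulus, which then equals
      the real part \<open>u (w x)\<close> and is bounded by \<open>norm x\<close>. If
      \<open>f x = 0\<close>, the value 1 serves.\<close>
    obtain w where w: "cmod w = 1" "w * f x = of_real (cmod (f x))"
    proof (cases "f x = 0")
      case True
      then show ?thesis by (intro that[of 1]) auto
    next
      case False
      then show ?thesis
        by (intro that[of "of_real (cmod (f x)) / f x"]) (auto simp: norm_divide)
    qed
    have "cmod (f x) = Re (f (w *\<^sub>C x))"
      by (simp add: scale scaleC_complex_def w)
    also have "\<dots> \<le> norm (w *\<^sub>C x)"
      using u(2)[of "w *\<^sub>C x"] by (simp add: f_def)
    finally show ?thesis by (simp add: norm_scaleC w)
  qed
  obtain F where F: "cblinfun_apply F = f"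
    using obtain_cblinfun[OF add scale, where K = 1] bound by auto
  show ?thesis
  proof (rule that)
    show "norm F \<le> 1"
      by (rule norm_cblinfun_bound) (use bound in \<open>auto simp: F\<close>)
    \<comment> \<open>The real part of \<open>f y\<close> is already \<open>norm y\<close>.\<close>
    show "norm y \<le> cmod (cblinfun_apply F y)"
      using complex_Re_le_cmod[of "f y"] by (simp add: F f_def u)
  qed
qed

section \<open>The canonical embedding into the complex bidual\<close>

lift_definition cbidual_embedding ::
  "'a::complex_normed_vector \<Rightarrow> ('a \<Rightarrow>\<^sub>C\<^sub>L complex) \<Rightarrow>\<^sub>C\<^sub>L complex"
  is "\<lambda>x f. cblinfun_apply f x"
proof (intro conjI allI)
  fix x :: 'a
  show "bounded_linear (\<lambda>f :: 'a \<Rightarrow>\<^sub>C\<^sub>L complex. cblinfun_apply f x)"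
    by (rule bounded_linear_intro[where K = "norm x"])
      (auto simp: cblinfun_simps norm_cblinfun simp flip: scaleC_of_real)
qed (simp add: cblinfun_simps)

lemma cbidual_embedding_add:
  "cbidual_embedding (x + y) = cbidual_embedding x + cbidual_embedding y"
  by (rule cblinfun_eqI) (simp add: cbidual_embedding.rep_eq cblinfun_simps)

lemma cbidual_embedding_diff:
  "cbidual_embedding (x - y) = cbidual_embedding x - cbidual_embedding y"
  by (rule cblinfun_eqI) (simp add: cbidual_embedding.rep_eq cblinfun_simps)

lemma cbidual_embedding_scaleC: "cbidual_embedding (c *\<^sub>C x) = c *\<^sub>C cbidual_embedding x"
  by (rule cblinfun_eqI) (simp add: cbidual_embedding.rep_eq cblinfun_simps)

text \<open>The argument of the real case, now with a complex norming functional.\<close>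

lemma norm_cbidual_embedding: "norm (cbidual_embedding x) = norm x"
proof (rule antisym)
  show "norm (cbidual_embedding x) \<le> norm x"
  proof (rule norm_cblinfun_bound)
    show "norm (cblinfun_apply (cbidual_embedding x) f) \<le> norm x * norm f" for f
      using norm_cblinfun[of f x] by (simp add: cbidual_embedding.rep_eq mult.commute)
  qed simp
  obtain F :: "'a \<Rightarrow>\<^sub>C\<^sub>L complex" where F: "norm F \<le> 1" "norm x \<le> cmod (cblinfun_apply F x)"
    using complex_norming_functional .
  have "norm x \<le> norm (cbidual_embedding x) * norm F"
    using norm_cblinfun[of "cbidual_embedding x" F] F(2) by (simp add: cbidual_embedding.rep_eq)
  also have "\<dots> \<le> norm (cbidual_embedding x)"
    using F(1) by (simp add: mult_left_le)
  finally show "norm x \<le> norm (cbidual_embedding x)" .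
qed

lemma cbidual_embedding_eq_iff: "cbidual_embedding x = cbidual_embedding y \<longleftrightarrow> x = y"
  using norm_cbidual_embedding[of "x - y"] by (auto simp: cbidual_embedding_diff)

section \<open>Complex adjoints and second adjoints\<close>

lemma cdual_map_diff: "cdual_map (S - T) = cdual_map S - cdual_map T"
  by (intro cblinfun_eqI) (simp add: cdual_map.rep_eq cblinfun_compose.rep_eq cblinfun_simps)

lemma norm_cblinfun_compose: "norm (f o\<^sub>C\<^sub>L g) \<le> norm f * norm g"
  by transfer (auto intro: onorm_compose)

lemma norm_cdual_map_le: "norm (cdual_map T) \<le> norm T"
proof (rule norm_cblinfun_bound)
  show "norm (cblinfun_apply (cdual_map T) f) \<le> norm T * norm f" for f
    using norm_cblinfun_compose[of f T] by (simp add: cdual_map.rep_eq mult.commute)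
qed simp

lemma cdual_map_cdual_map_cbidual_embedding:
  "cblinfun_apply (cdual_map (cdual_map T)) (cbidual_embedding x) =
    cbidual_embedding (cblinfun_apply T x)"
  by (intro cblinfun_eqI)
    (simp add: cdual_map.rep_eq cblinfun_compose.rep_eq cbidual_embedding.rep_eq)

lemma range_cdual_map_cdual_map:
  fixes A :: "'a::complex_normed_vector \<Rightarrow>\<^sub>C\<^sub>L 'b::complex_normed_vector"
  assumes "range (cblinfun_apply A) \<subseteq> V"
  shows "range (cblinfun_apply (cdual_map (cdual_map A))) \<subseteq> cannihilator (cannihilator V)"
proof -
  have "f o\<^sub>C\<^sub>L A = 0" if "f \<in> cannihilator V" for f :: "'b \<Rightarrow>\<^sub>C\<^sub>L complex"
    using assms that
    by (intro cblinfun_eqI) (auto simp: cannihilator_def cblinfun_compose.rep_eq cblinfun_simps)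
  then show ?thesis
    by (auto simp: cannihilator_def cdual_map.rep_eq cblinfun_compose.rep_eq cblinfun_simps)
qed

section \<open>Double annihilators over the complex field\<close>

lemma linear_cblinfun_apply: "Vector_Spaces.linear scaleC (*) (cblinfun_apply f)"
  for f :: "'a::complex_normed_vector \<Rightarrow>\<^sub>C\<^sub>L complex"
  by (simp add: Vector_Spaces.linear_iff cblinfun_simps scaleC_complex_def vector_space_scaleC)
    (simp add: vector_space_def algebra_simps)

text \<open>The same use of \<open>functional_eq_evaluation\<close>, with the complex numbers as its
  field.\<close>

lemma cannihilator_cannihilator_finite_dimensional:
  assumes "finite_dimensional scaleC V"
  shows "cannihilator (cannihilator V) = cbidual_embedding ` V"
proof
  show "cbidual_embedding ` V \<subseteq> cannihilator (cannihilator V)"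
    by (auto simp: cannihilator_def cbidual_embedding.rep_eq)
  show "cannihilator (cannihilator V) \<subseteq> cbidual_embedding ` V"
  proof
    fix \<phi>
    assume \<phi>: "\<phi> \<in> cannihilator (cannihilator V)"
    have "\<exists>x\<in>V. \<forall>f. cblinfun_apply \<phi> f = cblinfun_apply f x"
    proof (rule functional_eq_evaluation[OF linear_cblinfun_apply _ assms linear_cblinfun_apply])
      show "Vector_Spaces.linear scaleC (*) (\<lambda>f. cblinfun_apply f x)" for x :: 'a
        using linear_cblinfun_apply[of "cbidual_embedding x"]
        by (simp add: cbidual_embedding.rep_eq)
      show "cblinfun_apply \<phi> f = 0" if "\<forall>x\<in>V. cblinfun_apply f x = 0" for f
        using \<phi> that by (simp add: cannihilator_def)
    qed
    then show "\<phi> \<in> cbidual_embedding ` V"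
      by (auto simp: cbidual_embedding.rep_eq intro!: cblinfun_eqI image_eqI)
  qed
qed

section \<open>Approximants and approximation numbers, complex case\<close>

lemma cbidual_approximant_restricts:
  fixes T :: "'a::complex_normed_vector \<Rightarrow>\<^sub>C\<^sub>L 'a"
  assumes B: "range (cblinfun_apply B) \<subseteq> cbidual_embedding ` V"
  obtains A :: "'a \<Rightarrow>\<^sub>C\<^sub>L 'a" where "range (cblinfun_apply A) \<subseteq> V"
    "norm (T - A) \<le> norm (cdual_map (cdual_map T) - B)"
proof -
  have "cblinfun_apply B (cbidual_embedding x) \<in> cbidual_embedding ` V" for x
    using B by blast
  then have "\<forall>x. \<exists>v\<in>V. cbidual_embedding v = cblinfun_apply B (cbidual_embedding x)"
    by (metis imageE)
  then obtain a where a: "\<And>x. a x \<in> V"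
      "\<And>x. cbidual_embedding (a x) = cblinfun_apply B (cbidual_embedding x)"
    by metis
  \<comment> \<open>Preimages under the embedding are unique, so additivity and complex homogeneity
    pass from \<open>B\<close> to \<open>a\<close>.\<close>
  have add: "a (x + y) = a x + a y" for x y
    by (subst cbidual_embedding_eq_iff[symmetric])
      (simp add: a cbidual_embedding_add cblinfun_simps)
  have scale: "a (c *\<^sub>C x) = c *\<^sub>C a x" for c x
    by (subst cbidual_embedding_eq_iff[symmetric])
      (simp add: a cbidual_embedding_scaleC cblinfun_simps)
  have "norm (a x) \<le> norm x * norm B" for x
    using norm_cblinfun[of B "cbidual_embedding x"]
    by (simp add: a(2)[symmetric] norm_cbidual_embedding mult.commute)
  then obtain A where A: "cblinfun_apply A = a"
    using obtain_cblinfun[OF add scale] by blast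
  have "norm (T - A) \<le> norm (cdual_map (cdual_map T) - B)"
  proof (rule norm_cblinfun_bound)
    fix x
    have "cbidual_embedding (cblinfun_apply (T - A) x) =
        cblinfun_apply (cdual_map (cdual_map T) - B) (cbidual_embedding x)"
      by (simp add: A a cbidual_embedding_diff cblinfun_simps
          cdual_map_cdual_map_cbidual_embedding)
    then show "norm (cblinfun_apply (T - A) x) \<le> norm (cdual_map (cdual_map T) - B) * norm x"
      by (metis norm_cbidual_embedding norm_cblinfun)
  qed simp
  then show ?thesis
    using a by (intro that[of A]) (auto simp: A)
qed

lemma capprox_number_bidual:
  fixes T :: "'a::complex_normed_vector \<Rightarrow>\<^sub>C\<^sub>L 'a"
  assumes "finite_dimensional scaleC (Q n)" "0 \<in> Q n"
  shows "capprox_number T Q n =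
    capprox_number (cdual_map (cdual_map T)) (\<lambda>k. cannihilator (cannihilator (Q k))) n"
  unfolding capprox_number_def
proof (rule Inf_eq_of_mutual_le)
  let ?S = "{norm (T - A) | A. range (cblinfun_apply A) \<subseteq> Q n}"
  let ?S' = "{norm (cdual_map (cdual_map T) - B) | B.
    range (cblinfun_apply B) \<subseteq> cannihilator (cannihilator (Q n))}"
  have "range (cblinfun_apply (0 :: 'a \<Rightarrow>\<^sub>C\<^sub>L 'a)) \<subseteq> Q n"
    using assms(2) by (auto simp: cblinfun_simps)
  then show "?S \<noteq> {}"
    by blast
  show "\<exists>y\<in>?S'. y \<le> x" if "x \<in> ?S" for x
  proof -
    from that obtain A where A: "range (cblinfun_apply A) \<subseteq> Q n" "x = norm (T - A)"
      by blast
    have "norm (cdual_map (cdual_map T) - cdual_map (cdual_map A)) \<le> x"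
      unfolding A(2) cdual_map_diff[symmetric]
      by (rule order_trans[OF norm_cdual_map_le norm_cdual_map_le])
    then show ?thesis
      using range_cdual_map_cdual_map[OF A(1)] by blast
  qed
  show "\<exists>x\<in>?S. x \<le> y" if "y \<in> ?S'" for y
  proof -
    from that obtain B where B: "range (cblinfun_apply B) \<subseteq> cbidual_embedding ` Q n"
        "y = norm (cdual_map (cdual_map T) - B)"
      using cannihilator_cannihilator_finite_dimensional[OF assms(1)] by auto
    obtain A where "range (cblinfun_apply A) \<subseteq> Q n" "norm (T - A) \<le> y"
      unfolding B(2) by (rule cbidual_approximant_restricts[OF B(1)])
    then show ?thesis
      by blast
  qed
qed auto

text \<open>Zero lies in \<open>Q 0\<close> and is carried up the increasing chain. This makes the
  zero operator admissible at every level.\<close>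

lemma gen_approx_scheme_zero_mem: "0 \<in> Q n" if "gen_approx_scheme smul Q"
proof (induction n)
  case 0
  then show ?case using that by (simp add: gen_approx_scheme_def)
next
  case (Suc n)
  then show ?case using that by (auto simp: gen_approx_scheme_def)
qed

theorem theorem5p1:
  shows
    "(\<forall>(Q :: nat \<Rightarrow> 'a::banach set) (T :: 'a \<Rightarrow>\<^sub>L 'a) n.
        gen_approx_scheme scaleR Q \<and> (\<forall>k. finite_dimensional scaleR (Q k)) \<longrightarrow>
        approx_number T Q n =
          approx_number (dual_map (dual_map T)) (\<lambda>k. annihilator (annihilator (Q k))) n) \<and>
     (\<forall>(Q :: nat \<Rightarrow> 'b::cbanach set) (T :: 'b \<Rightarrow>\<^sub>C\<^sub>L 'b) n.
        gen_approx_scheme scaleC Q \<and> (\<forall>k. finite_dimensional scaleC (Q k)) \<longrightarrow>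
        capprox_number T Q n =
          capprox_number (cdual_map (cdual_map T)) (\<lambda>k. cannihilator (cannihilator (Q k))) n)"
  by (auto intro!: approx_number_bidual capprox_number_bidual
      intro: gen_approx_scheme_zero_mem)

end
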